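(* The bivariate generating function $F(u,z)=\sum_{n=1}^{\infty}\sum_{\mathcal{C}\in \mathrm{IC}(P_n)} u^{\mathrm{mix}(\mathcal{C})}z^n$ for integrated colorings of paths, counted according to the order $n$ of the path (variable $z$) and the mixing number of the coloring (variable $u$), is \[F(u,z)=\frac{2z-2uz^3}{1-uz-uz^2}.\]
   Context: Let $G=(V,E)$ be a finite labeled graph. A coloring of $G$ is an arbitrary map $\mathcal{C}: V \to \{\text{black},\text{white}\}$. An edge is balanced if its endpoints have different colors. The mixing number $\mathrm{mix}(\mathcal{C})$ is the number of balanced edges of $G$. For a vertex $v$, $\mathrm{mix}(v)$ is the number of balanced edges incident to $v$. A vertex $v$ is integrated if $\mathrm{mix}(v)\geq \frac12\deg(v)$, and $\mathcal{C}$ is integrated if every vertex is integrated. $\mathrm{IC}(G)$ is the set of integrated colorings of $G$. The path $P_n$ has vertices $1,\dots,n$ and edges $\{i,i+1\}$ for $1\le i\le n-1$. The identity is one of formal power series in $z$ with coefficients in $\mathbb{Z}[u]$. *)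

theory Defs
  imports
    "HOL-Computational_Algebra.Computational_Algebra"
    "HOL-Library.FuncSet"
begin

type_synonym 'a graph = "'a set \<times> 'a set set"

abbreviation verts :: "'a graph \<Rightarrow> 'a set" where
  "verts G \<equiv> fst G"

abbreviation edges :: "'a graph \<Rightarrow> 'a set set" where
  "edges G \<equiv> snd G"

definition finite_graph :: "'a graph \<Rightarrow> bool" where
  "finite_graph G \<longleftrightarrow> finite (verts G) \<and> (\<forall>e\<in>edges G. e \<subseteq> verts G \<and> card e = 2)"

datatype colour = Black | White

text \<open>Colourings are extensional (\<open>undefined\<close> outside the vertex set), so that maps which
  agree on all vertices are counted once.\<close>

definition colourings :: "'a graph \<Rightarrow> ('a \<Rightarrow> colour) set" where
  "colourings G = verts G \<rightarrow>\<^sub>E UNIV"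

definition balanced :: "('a \<Rightarrow> colour) \<Rightarrow> 'a set \<Rightarrow> bool" where
  "balanced C e \<longleftrightarrow> (\<exists>v w. e = {v, w} \<and> C v \<noteq> C w)"

definition mix :: "'a graph \<Rightarrow> ('a \<Rightarrow> colour) \<Rightarrow> nat" where
  "mix G C = card {e \<in> edges G. balanced C e}"

definition mix_at :: "'a graph \<Rightarrow> ('a \<Rightarrow> colour) \<Rightarrow> 'a \<Rightarrow> nat" where
  "mix_at G C v = card {e \<in> edges G. v \<in> e \<and> balanced C e}"

definition deg :: "'a graph \<Rightarrow> 'a \<Rightarrow> nat" where
  "deg G v = card {e \<in> edges G. v \<in> e}"

definition integrated_at :: "'a graph \<Rightarrow> ('a \<Rightarrow> colour) \<Rightarrow> 'a \<Rightarrow> bool" where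
  "integrated_at G C v \<longleftrightarrow> real (mix_at G C v) \<ge> 1 / 2 * real (deg G v)"

definition integrated_colourings :: "'a graph \<Rightarrow> ('a \<Rightarrow> colour) set" where
  "integrated_colourings G = {C \<in> colourings G. \<forall>v\<in>verts G. integrated_at G C v}"

definition path_graph :: "nat \<Rightarrow> nat graph" where
  "path_graph n = ({1..n}, {{i, i + 1} | i. 1 \<le> i \<and> i < n})"

lemma finite_graph_path: "finite_graph (path_graph n)"
  by (auto simp: finite_graph_def path_graph_def)

lemma finite_integrated_colourings:
  assumes "finite_graph G"
  shows "finite (integrated_colourings G)"
proof -
  have "(UNIV :: colour set) = {Black, White}"
    using colour.exhaust by auto
  then have "finite (UNIV :: colour set)"
    by (metis finite.emptyI finite.insertI)
  then have "finite (colourings G)"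
    using assms by (auto simp: colourings_def finite_graph_def intro!: finite_PiE)
  then show ?thesis
    by (simp add: integrated_colourings_def)
qed

abbreviation var_u :: "int poly fps" where
  "var_u \<equiv> fps_const [:0, 1:]"

abbreviation var_z :: "int poly fps" where
  "var_z \<equiv> fps_X"

text \<open>The guard on \<open>n\<close> excludes the empty path, whose empty colouring would otherwise
  contribute 1.\<close>

definition path_gf :: "int poly fps" where
  "path_gf = Abs_fps (\<lambda>n. if n = 0 then 0
     else \<Sum>C\<in>integrated_colourings (path_graph n). [:0, 1:] ^ mix (path_graph n) C)"

text \<open>The library's division of power series needs an inverse operation on the coefficients,
  which \<^typ>\<open>int poly\<close> lacks. For a denominator with constant coefficient 1 the quotient is
  nevertheless defined over every commutative ring, through the multiplicative inverse.\<close>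

definition fps_quot :: "'a::comm_ring_1 fps \<Rightarrow> 'a fps \<Rightarrow> 'a fps" where
  "fps_quot f g = f * fps_right_inverse g 1"

lemma fps_quot_unique:
  assumes "fps_nth g 0 = 1"
  shows "h = fps_quot f g \<longleftrightarrow> h * g = f"
proof -
  have inv: "g * fps_right_inverse g 1 = 1"
    using assms by (intro fps_right_inverse) simp
  show ?thesis
  proof
    assume "h = fps_quot f g"
    then have "h * g = f * (g * fps_right_inverse g 1)"
      by (simp add: fps_quot_def mult_ac)
    then show "h * g = f"
      by (simp add: inv)
  next
    assume "h * g = f"
    then have "fps_quot f g = h * (g * fps_right_inverse g 1)"
      by (simp add: fps_quot_def flip: mult.assoc)
    then show "h = fps_quot f g"
      by (simp add: inv)
  qed
qed

end

theory Submission
  imports Defs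
begin

text \<open>
  Every vertex of a path has degree at most 2, so as soon as there are at least two vertices,
  being integrated just means having a neighbour of the other colour
  (\<open>integrated_at_path_iff\<close>). In particular the end edges of the path are balanced, and no two
  consecutive edges are unbalanced.

  Hence an integrated colouring of a longer path can be peeled from its right end, whose last
  edge is balanced. If the edge before it is balanced too, removing the last vertex
  leaves an integrated colouring; this step is reversed by appending one vertex of the opposite
  colour (\<open>bij_betw_append_opposite\<close>). If that edge is unbalanced, the edge
  preceding it must be balanced, and removing the last two vertices leaves an integrated
  colouring; this step is reversed by repeating the last colour once and then switching
  (\<open>bij_betw_append_repeat\<close>). Either step removes exactly one balanced edge, so the mixing
  polynomials satisfy \<open>a\<^sub>n = u a\<^sub>n\<^sub>-\<^sub>1 + u a\<^sub>n\<^sub>-\<^sub>2\<close>.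

  The second case needs a remaining path with at least two vertices: repeating the colour of a
  single vertex leaves that vertex without a neighbour of the other colour. So the recurrence
  holds for \<open>n \<ge> 4\<close>, while \<open>a\<^sub>1 = 2\<close>, \<open>a\<^sub>2 = u a\<^sub>1\<close> and \<open>a\<^sub>3 = u a\<^sub>2\<close>. The missing term \<open>u a\<^sub>1\<close> at
  \<open>n = 3\<close> is what the summand \<open>-2uz\<^sup>3\<close> of the numerator accounts for.
\<close>

section \<open>Balanced edges of a path\<close>

lemma balanced_pair_iff: "balanced C {i, j} \<longleftrightarrow> C i \<noteq> C j"
  by (auto simp: balanced_def doubleton_eq_iff)

text \<open>Edges are indexed by their left endpoints, which turns all edge counts on a path into
  counts of natural numbers.\<close>

lemma card_path_edges:
  "card {e \<in> edges (path_graph n). P e} = card {i \<in> {1..<n}. P {i, i + 1}}"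
proof -
  have "{e \<in> edges (path_graph n). P e} = (\<lambda>i. {i, i + 1}) ` {i \<in> {1..<n}. P {i, i + 1}}"
    by (auto simp: path_graph_def)
  moreover have "inj_on (\<lambda>i::nat. {i, i + 1}) {i \<in> {1..<n}. P {i, i + 1}}"
    by (auto simp: inj_on_def doubleton_eq_iff)
  ultimately show ?thesis
    by (simp add: card_image)
qed

lemma mix_path: "mix (path_graph n) C = card {i \<in> {1..<n}. C i \<noteq> C (i + 1)}"
  unfolding mix_def card_path_edges by (simp add: balanced_pair_iff)

lemma card_path_edges_at:
  assumes "v \<in> {1..n}"
  shows "card {e \<in> edges (path_graph n). v \<in> e \<and> P e}
    = of_bool (1 < v \<and> P {v - 1, v}) + of_bool (v < n \<and> P {v, v + 1})"
proof -
  have incident: "{i \<in> {1..<n}. v \<in> {i, i + 1} \<and> P {i, i + 1}}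
    = (if 1 < v \<and> P {v - 1, v} then {v - 1} else {}) \<union> (if v < n \<and> P {v, v + 1} then {v} else {})"
    using assms by (auto split: if_splits)
  show ?thesis
    unfolding card_path_edges incident using assms by (auto simp: of_bool_def card_insert_if)
qed

text \<open>A vertex of positive degree at most 2 has at least half of its edges balanced iff it has
  one balanced edge; the degree is 0 only on the one-vertex path, where the
  condition is void.\<close>

lemma integrated_at_path_iff:
  assumes "v \<in> {1..n}"
  shows "integrated_at (path_graph n) C v \<longleftrightarrow>
    n = 1 \<or> (1 < v \<and> C (v - 1) \<noteq> C v) \<or> (v < n \<and> C v \<noteq> C (v + 1))"
proof -
  have "deg (path_graph n) v = of_bool (1 < v) + of_bool (v < n)"
    using card_path_edges_at[OF assms, of "\<lambda>_. True"] by (simp add: deg_def)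
  moreover have "mix_at (path_graph n) C v
    = of_bool (1 < v \<and> C (v - 1) \<noteq> C v) + of_bool (v < n \<and> C v \<noteq> C (v + 1))"
    using card_path_edges_at[OF assms, of "balanced C"]
    by (simp add: mix_at_def balanced_pair_iff)
  ultimately show ?thesis
    using assms by (auto simp: integrated_at_def of_bool_def split: if_splits)
qed

lemma mem_integrated_colourings_path_iff:
  "C \<in> integrated_colourings (path_graph n) \<longleftrightarrow>
    C \<in> extensional {1..n} \<and>
    (n = 1 \<or> (\<forall>v\<in>{1..n}. (1 < v \<and> C (v - 1) \<noteq> C v) \<or> (v < n \<and> C v \<noteq> C (v + 1))))"
proof -
  have "verts (path_graph n) = {1..n}"
    by (simp add: path_graph_def)
  then show ?thesis
    using integrated_at_path_iff[of _ n C]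
    by (auto simp: integrated_colourings_def colourings_def PiE_def)
qed

text \<open>Each end vertex has only one neighbour, so the end edges are balanced.\<close>

lemma integrated_path_ends:
  assumes "C \<in> integrated_colourings (path_graph n)" "2 \<le> n"
  shows "C 1 \<noteq> C 2" "C (n - 1) \<noteq> C n"
proof -
  have *: "(1 < v \<and> C (v - 1) \<noteq> C v) \<or> (v < n \<and> C v \<noteq> C (v + 1))" if "v \<in> {1..n}" for v
    using assms that by (auto simp: mem_integrated_colourings_path_iff)
  show "C 1 \<noteq> C 2"
    using *[of 1] assms(2) by (simp add: numeral_2_eq_2)
  show "C (n - 1) \<noteq> C n"
    using *[of n] assms(2) by simp
qed

section \<open>Extending colourings at the right end\<close>

fun opposite :: "colour \<Rightarrow> colour" where
  "opposite Black = White"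
| "opposite White = Black"

lemma opposite_neq [simp]: "opposite c \<noteq> c" "c \<noteq> opposite c"
  by (cases c; simp)+

lemma opposite_eqI: "c \<noteq> d \<Longrightarrow> opposite c = d"
  by (cases c; cases d; simp)

definition append_opposite :: "nat \<Rightarrow> (nat \<Rightarrow> colour) \<Rightarrow> nat \<Rightarrow> colour" where
  "append_opposite n C = C(n + 1 := opposite (C n))"

definition append_repeat :: "nat \<Rightarrow> (nat \<Rightarrow> colour) \<Rightarrow> nat \<Rightarrow> colour" where
  "append_repeat n C = C(n + 1 := C n, n + 2 := opposite (C n))"

lemma mix_append_opposite:
  assumes "1 \<le> n"
  shows "mix (path_graph (n + 1)) (append_opposite n C) = mix (path_graph n) C + 1"
proof -
  have "{i \<in> {1..<n + 1}. append_opposite n C i \<noteq> append_opposite n C (i + 1)}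
    = insert n {i \<in> {1..<n}. C i \<noteq> C (i + 1)}"
    using assms by (auto simp: append_opposite_def)
  then show ?thesis
    unfolding mix_path by simp
qed

lemma mix_append_repeat:
  assumes "1 \<le> n"
  shows "mix (path_graph (n + 2)) (append_repeat n C) = mix (path_graph n) C + 1"
proof -
  have "{i \<in> {1..<n + 2}. append_repeat n C i \<noteq> append_repeat n C (i + 1)}
    = insert (n + 1) {i \<in> {1..<n}. C i \<noteq> C (i + 1)}"
    using assms by (auto simp: append_repeat_def less_Suc_eq)
  then show ?thesis
    unfolding mix_path by simp
qed

text \<open>Removing the last vertex can only hurt its neighbour, whose other edge
  is required to be balanced. That edge does not exist if \<open>n = 1\<close>, but the one-vertex path has no
  condition to satisfy.\<close>

lemma bij_betw_append_opposite:
  assumes "1 \<le> n"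
  shows "bij_betw (append_opposite n) (integrated_colourings (path_graph n))
    {C \<in> integrated_colourings (path_graph (n + 1)). n = 1 \<or> C (n - 1) \<noteq> C n}"
    (is "bij_betw _ ?A ?B")
proof (rule bij_betw_byWitness[where f' = "\<lambda>C. restrict C {1..n}"])
  show "\<forall>C\<in>?A. restrict (append_opposite n C) {1..n} = C"
    by (auto simp: mem_integrated_colourings_path_iff append_opposite_def extensional_def fun_eq_iff)
  show "\<forall>C\<in>?B. append_opposite n (restrict C {1..n}) = C"
  proof
    fix C assume "C \<in> ?B"
    moreover from this have "opposite (C n) = C (n + 1)"
      using integrated_path_ends(2)[of C "n + 1"] assms by (intro opposite_eqI) simp
    ultimately show "append_opposite n (restrict C {1..n}) = C"
      using assms
      by (auto simp: mem_integrated_colourings_path_iff append_opposite_def extensional_def fun_eq_iff)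
  qed
  show "append_opposite n ` ?A \<subseteq> ?B"
  proof (rule image_subsetI)
    fix C assume C: "C \<in> ?A"
    let ?D = "append_opposite n C"
    have "(1 < v \<and> ?D (v - 1) \<noteq> ?D v) \<or> (v < n + 1 \<and> ?D v \<noteq> ?D (v + 1))"
      if v: "v \<in> {1..n + 1}" for v
    proof (cases "v < n")
      case True
      then show ?thesis
        using C v by (auto simp: mem_integrated_colourings_path_iff append_opposite_def)
    next
      case False
      then have "v = n \<or> v = n + 1"
        using v by auto
      then show ?thesis
        using assms by (auto simp: append_opposite_def)
    qed
    moreover have "?D \<in> extensional {1..n + 1}"
      using C by (auto simp: mem_integrated_colourings_path_iff append_opposite_def extensional_def)
    moreover have "n = 1 \<or> ?D (n - 1) \<noteq> ?D n"
      using integrated_path_ends(2)[OF C] assms by (auto simp: append_opposite_def)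
    ultimately show "?D \<in> ?B"
      by (simp add: mem_integrated_colourings_path_iff)
  qed
  show "(\<lambda>C. restrict C {1..n}) ` ?B \<subseteq> ?A"
  proof (rule image_subsetI)
    fix C assume C: "C \<in> ?B"
    let ?D = "restrict C {1..n}"
    have "(1 < v \<and> ?D (v - 1) \<noteq> ?D v) \<or> (v < n \<and> ?D v \<noteq> ?D (v + 1))"
      if v: "v \<in> {1..n}" and "n \<noteq> 1" for v
    proof (cases "v = n")
      case True
      then show ?thesis
        using C assms that by auto
    next
      case False
      moreover have "(1 < v \<and> C (v - 1) \<noteq> C v) \<or> (v < n + 1 \<and> C v \<noteq> C (v + 1))"
        using C v by (auto simp: mem_integrated_colourings_path_iff)
      ultimately show ?thesis
        using v by auto
    qed
    moreover have "?D \<in> extensional {1..n}"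
      by simp
    ultimately show "?D \<in> ?A"
      unfolding mem_integrated_colourings_path_iff by blast
  qed
qed

text \<open>If the last edge but one is unbalanced, its left endpoint must have a balanced edge on the
  left, so that this vertex stays integrated when it becomes the new end. Conversely, appending
  takes no balanced edge away from the old end vertex, but leaves it without one if it was
  alone; hence \<open>2 \<le> n\<close>.\<close>

lemma bij_betw_append_repeat:
  assumes "2 \<le> n"
  shows "bij_betw (append_repeat n) (integrated_colourings (path_graph n))
    {C \<in> integrated_colourings (path_graph (n + 2)). C n = C (n + 1)}"
    (is "bij_betw _ ?A ?B")
proof (rule bij_betw_byWitness[where f' = "\<lambda>C. restrict C {1..n}"])
  show "\<forall>C\<in>?A. restrict (append_repeat n C) {1..n} = C"
    by (auto simp: mem_integrated_colourings_path_iff append_repeat_def extensional_def fun_eq_iff)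
  show "\<forall>C\<in>?B. append_repeat n (restrict C {1..n}) = C"
  proof
    fix C assume "C \<in> ?B"
    moreover from this have "opposite (C (n + 1)) = C (n + 2)"
      using integrated_path_ends(2)[of C "n + 2"] by (intro opposite_eqI) simp
    ultimately show "append_repeat n (restrict C {1..n}) = C"
      using assms
      by (auto simp: mem_integrated_colourings_path_iff append_repeat_def extensional_def fun_eq_iff)
  qed
  show "append_repeat n ` ?A \<subseteq> ?B"
  proof (rule image_subsetI)
    fix C assume C: "C \<in> ?A"
    let ?D = "append_repeat n C"
    have "(1 < v \<and> ?D (v - 1) \<noteq> ?D v) \<or> (v < n + 2 \<and> ?D v \<noteq> ?D (v + 1))"
      if v: "v \<in> {1..n + 2}" for v
    proof (cases "v \<le> n")
      case True
      then have "(1 < v \<and> C (v - 1) \<noteq> C v) \<or> (v < n \<and> C v \<noteq> C (v + 1))"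
        using C v assms by (auto simp: mem_integrated_colourings_path_iff)
      then show ?thesis
        using True v by (auto simp: append_repeat_def)
    next
      case False
      then have "v = n + 1 \<or> v = n + 2"
        using v by auto
      then show ?thesis
        by (auto simp: append_repeat_def)
    qed
    moreover have "?D \<in> extensional {1..n + 2}"
      using C by (auto simp: mem_integrated_colourings_path_iff append_repeat_def extensional_def)
    moreover have "?D n = ?D (n + 1)"
      by (simp add: append_repeat_def)
    ultimately show "?D \<in> ?B"
      by (simp add: mem_integrated_colourings_path_iff)
  qed
  show "(\<lambda>C. restrict C {1..n}) ` ?B \<subseteq> ?A"
  proof (rule image_subsetI)
    fix C assume C: "C \<in> ?B"
    let ?D = "restrict C {1..n}"
    have "(1 < v \<and> ?D (v - 1) \<noteq> ?D v) \<or> (v < n \<and> ?D v \<noteq> ?D (v + 1))"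
      if v: "v \<in> {1..n}" for v
    proof -
      have "(1 < v \<and> C (v - 1) \<noteq> C v) \<or> (v < n + 2 \<and> C v \<noteq> C (v + 1))"
        using C v by (auto simp: mem_integrated_colourings_path_iff)
      moreover have "C n = C (n + 1)"
        using C by simp
      ultimately show ?thesis
        using v by (cases "v = n") auto
    qed
    moreover have "?D \<in> extensional {1..n}"
      by simp
    ultimately show "?D \<in> ?A"
      unfolding mem_integrated_colourings_path_iff by blast
  qed
qed

section \<open>The mixing polynomials of paths\<close>

definition path_mixing_poly :: "nat \<Rightarrow> int poly" where
  "path_mixing_poly n
    = (\<Sum>C\<in>integrated_colourings (path_graph n). [:0, 1:] ^ mix (path_graph n) C)"

lemma sum_append_opposite:
  assumes "1 \<le> n"
  shows "(\<Sum>C | C \<in> integrated_colourings (path_graph (n + 1)) \<and> (n = 1 \<or> C (n - 1) \<noteq> C n).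
      [:0, 1:] ^ mix (path_graph (n + 1)) C) = [:0, 1:] * path_mixing_poly n"
  unfolding path_mixing_poly_def sum_distrib_left
    sum.reindex_bij_betw[OF bij_betw_append_opposite[OF assms], symmetric]
    mix_append_opposite[OF assms]
  by (simp add: mult.commute)

lemma sum_append_repeat:
  assumes "2 \<le> n"
  shows "(\<Sum>C | C \<in> integrated_colourings (path_graph (n + 2)) \<and> C n = C (n + 1).
      [:0, 1:] ^ mix (path_graph (n + 2)) C) = [:0, 1:] * path_mixing_poly n"
proof -
  have "1 \<le> n"
    using assms by simp
  then show ?thesis
    unfolding path_mixing_poly_def sum_distrib_left
      sum.reindex_bij_betw[OF bij_betw_append_repeat[OF assms], symmetric]
    by (simp only: mix_append_repeat power_Suc Suc_eq_plus1[symmetric])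
qed

lemma path_mixing_poly_1: "path_mixing_poly 1 = 2"
proof -
  have "integrated_colourings (path_graph 1) = {(\<lambda>_. undefined)(1 := Black), (\<lambda>_. undefined)(1 := White)}"
    (is "_ = {?b, ?w}")
  proof (intro equalityI subsetI)
    fix C assume C: "C \<in> integrated_colourings (path_graph 1)"
    show "C \<in> {?b, ?w}"
      using C by (cases "C 1")
        (auto simp: mem_integrated_colourings_path_iff extensional_def fun_eq_iff)
  next
    fix C assume "C \<in> {?b, ?w}"
    then show "C \<in> integrated_colourings (path_graph 1)"
      by (auto simp: mem_integrated_colourings_path_iff extensional_def)
  qed
  moreover have "?b \<noteq> ?w"
    by (auto simp: fun_eq_iff)
  ultimately show ?thesis
    by (simp add: path_mixing_poly_def mix_path)
qed

text \<open>For at most three vertices every edge is an end edge, so the last edge but one, if there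
  is one, is never unbalanced.\<close>

lemma path_mixing_poly_short:
  assumes "n = 1 \<or> n = 2"
  shows "path_mixing_poly (n + 1) = [:0, 1:] * path_mixing_poly n"
proof -
  have "n = 1 \<or> C (n - 1) \<noteq> C n" if "C \<in> integrated_colourings (path_graph (n + 1))" for C
    using integrated_path_ends(1)[OF that] assms by auto
  then have "{C. C \<in> integrated_colourings (path_graph (n + 1)) \<and> (n = 1 \<or> C (n - 1) \<noteq> C n)}
    = integrated_colourings (path_graph (n + 1))"
    by blast
  then show ?thesis
    using sum_append_opposite[of n] assms unfolding path_mixing_poly_def[of "n + 1"] by auto
qed

lemma path_mixing_poly_recurrence:
  assumes "2 \<le> n"
  shows "path_mixing_poly (n + 2)
    = [:0, 1:] * path_mixing_poly (n + 1) + [:0, 1:] * path_mixing_poly n"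
proof -
  let ?I = "integrated_colourings (path_graph (n + 2))"
  let ?f = "\<lambda>C. [:0, 1::int:] ^ mix (path_graph (n + 2)) C"
  have fin: "finite ?I"
    by (intro finite_integrated_colourings finite_graph_path)
  have "path_mixing_poly (n + 2)
    = sum ?f ({C. C \<in> ?I \<and> C n \<noteq> C (n + 1)} \<union> {C. C \<in> ?I \<and> C n = C (n + 1)})"
    unfolding path_mixing_poly_def by (intro sum.cong) auto
  also have "\<dots> = sum ?f {C. C \<in> ?I \<and> C n \<noteq> C (n + 1)} + sum ?f {C. C \<in> ?I \<and> C n = C (n + 1)}"
    using fin by (intro sum.union_disjoint) auto
  also have "sum ?f {C. C \<in> ?I \<and> C n \<noteq> C (n + 1)} = [:0, 1:] * path_mixing_poly (n + 1)"
    using sum_append_opposite[of "n + 1"] assms by simp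
  finally show ?thesis
    using sum_append_repeat[OF assms] by simp
qed

section \<open>The generating function\<close>

theorem theorem6:
  shows "path_gf = fps_quot (2 * var_z - 2 * var_u * var_z ^ 3)
                            (1 - var_u * var_z - var_u * var_z ^ 2)"
proof -
  have "path_gf * (1 - var_u * var_z - var_u * var_z ^ 2) = 2 * var_z - 2 * var_u * var_z ^ 3"
    (is "?l = ?r")
  proof (rule fps_ext)
    fix n
    let ?a = "\<lambda>n. if n = 0 then 0 else path_mixing_poly n"
    have gf: "fps_nth path_gf k = ?a k" for k
      by (simp add: path_gf_def path_mixing_poly_def)
    have "?l = path_gf - var_u * (var_z * path_gf) - var_u * (var_z ^ 2 * path_gf)"
      by (simp add: algebra_simps)
    then have l: "fps_nth ?l n = ?a n - [:0, 1:] * (if n = 0 then 0 else ?a (n - 1))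
        - [:0, 1:] * (if n < 2 then 0 else ?a (n - 2))"
      by (simp only: fps_sub_nth fps_mult_left_const_nth fps_X_mult_nth fps_X_power_mult_nth gf)
    have "?r = fps_const 2 * var_z - fps_const (2 * [:0, 1:]) * var_z ^ 3"
      by (simp add: numeral_fps_const flip: fps_const_mult)
    then have r: "fps_nth ?r n = 2 * of_bool (n = 1) - 2 * [:0, 1:] * of_bool (n = 3)"
      by (simp only: fps_sub_nth fps_mult_left_const_nth fps_X_nth fps_X_power_nth of_bool_def)
    consider "n = 0" | "n = 1" | "n = 2" | "n = 3" | "4 \<le> n"
      by linarith
    then show "fps_nth ?l n = fps_nth ?r n"
    proof cases
      case 1
      then show ?thesis
        unfolding l r by simp
    next
      case 2
      then show ?thesis
        using path_mixing_poly_1 unfolding l r by simp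
    next
      case 3
      then show ?thesis
        using path_mixing_poly_short[of 1] unfolding l r by (simp add: numeral_2_eq_2)
    next
      case 4
      then show ?thesis
        using path_mixing_poly_short[of 2] path_mixing_poly_1 unfolding l r by simp
    next
      case 5
      then have "path_mixing_poly n
          = [:0, 1:] * path_mixing_poly (n - 1) + [:0, 1:] * path_mixing_poly (n - 2)"
        using path_mixing_poly_recurrence[of "n - 2"] by (simp add: numeral_2_eq_2 Suc_diff_Suc)
      then show ?thesis
        using 5 unfolding l r by simp
    qed
  qed
  then show ?thesis
    by (subst fps_quot_unique) simp_all
qed

end
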